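(* Let $G$ be a finite group of linear automorphisms of the finite dimensional vector space $V$ over a field $k$, let $W$ be the subgroup of $G$ generated by the elements of $G$ that fix some linear hyperplane of $V$ point-wise, and let $H$ and $K$ be subgroups of $G$ such that $W\leq K\leq G$. Suppose $G=KH$, $k[V]^{K\cap H}$ is free as a module over $k[V]^K$, and $k[V]^{K\cap H}$ is generated (as an algebra) by $k[V]^K$ and $k[V]^H$. Then $k[V]^H$ is free as a module over $k[V]^G$.
   Context: $k$ is a field of arbitrary characteristic; $k[V]$ is the coordinate ring of $V$ (polynomial algebra on a basis of $V^*$, standard grading) with the induced $G$-action. For a subgroup $L\leq G$, $k[V]^L$ is the ring of $L$-invariants. *)

theory Defs
  imports Complex_Main "HOL-Algebra.Generated_Groups" "HOL-Library.Poly_Mapping"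
begin

definition GL :: "('k::field \<Rightarrow> 'v::ab_group_add \<Rightarrow> 'v) \<Rightarrow> ('v \<Rightarrow> 'v) monoid" where
  "GL scale = \<lparr>carrier = {g. Vector_Spaces.linear scale scale g \<and> bij g}, mult = (\<circ>), one = id\<rparr>"

definition hyperplane :: "('k::field \<Rightarrow> 'v::ab_group_add \<Rightarrow> 'v) \<Rightarrow> 'v set \<Rightarrow> bool" where
  "hyperplane scale U \<longleftrightarrow>
     module.subspace scale U \<and> vector_space.dim scale U + 1 = vector_space.dim scale UNIV"

definition fixes_hyperplane ::
    "('k::field \<Rightarrow> 'v::ab_group_add \<Rightarrow> 'v) \<Rightarrow> ('v \<Rightarrow> 'v) \<Rightarrow> bool" where
  "fixes_hyperplane scale g \<longleftrightarrow> (\<exists>U. hyperplane scale U \<and> (\<forall>u\<in>U. g u = u))"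

text \<open>
  Formal polynomials: a monomial is a finitely supported exponent function, a polynomial is a
  finitely supported coefficient function on monomials, with the convolution product of
  \<^theory>\<open>HOL-Library.Poly_Mapping\<close>. (Polynomial functions would not do over a finite field.)
\<close>

type_synonym ('x, 'k) mpoly = "('x \<Rightarrow>\<^sub>0 nat) \<Rightarrow>\<^sub>0 'k"

definition mconst :: "'k::zero \<Rightarrow> ('x, 'k) mpoly" where
  "mconst c = Poly_Mapping.single 0 c"

definition mvar :: "'x \<Rightarrow> ('x, 'k::zero_neq_one) mpoly" where
  "mvar x = Poly_Mapping.single (Poly_Mapping.single x 1) 1"

definition msubst :: "('x \<Rightarrow> ('y, 'k) mpoly) \<Rightarrow> ('x, 'k) mpoly \<Rightarrow> ('y, 'k::comm_ring_1) mpoly" where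
  "msubst \<sigma> p = (\<Sum>m\<in>Poly_Mapping.keys p. mconst (Poly_Mapping.lookup p m) *
                    (\<Prod>x\<in>Poly_Mapping.keys m. \<sigma> x ^ Poly_Mapping.lookup m x))"

text \<open>
  Given a basis \<open>B\<close> of \<open>V\<close>, the indeterminate \<open>mvar b\<close> for \<open>b \<in> B\<close> stands for the coordinate function
  of \<open>b\<close>, an element of the basis of \<open>V\<^sup>*\<close> dual to \<open>B\<close>. Thus \<open>coord_ring B\<close> is \<open>k[V]\<close>, and
  \<open>linear_form B \<phi>\<close> is the functional \<open>\<phi>\<close>, regarded as an element of \<open>k[V]\<close> of degree 1.
\<close>

definition coord_ring :: "'v set \<Rightarrow> ('v, 'k::comm_ring_1) mpoly set" where
  "coord_ring B = {p. \<forall>m\<in>Poly_Mapping.keys p. Poly_Mapping.keys m \<subseteq> B}"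

definition linear_form :: "'v set \<Rightarrow> ('v \<Rightarrow> 'k::comm_ring_1) \<Rightarrow> ('v, 'k) mpoly" where
  "linear_form B \<phi> = (\<Sum>c\<in>B. mconst (\<phi> c) * mvar c)"

text \<open>
  The action of \<open>g\<close> on \<open>k[V]\<close> is the algebra homomorphism extending the contragredient action
  \<open>\<phi> \<mapsto> \<phi> \<circ> g\<inverse>\<close> on \<open>V\<^sup>*\<close>.
\<close>

definition poly_act ::
    "('k::field \<Rightarrow> 'v::ab_group_add \<Rightarrow> 'v) \<Rightarrow> 'v set \<Rightarrow> ('v \<Rightarrow> 'v) \<Rightarrow> ('v, 'k) mpoly \<Rightarrow> ('v, 'k) mpoly" where
  "poly_act scale B g =
     msubst (\<lambda>b. linear_form B (\<lambda>v. module.representation scale B (inv_into UNIV g v) b))"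

definition invariant_ring ::
    "('k::field \<Rightarrow> 'v::ab_group_add \<Rightarrow> 'v) \<Rightarrow> 'v set \<Rightarrow> ('v \<Rightarrow> 'v) set \<Rightarrow> ('v, 'k) mpoly set" where
  "invariant_ring scale B L = {p \<in> coord_ring B. \<forall>g\<in>L. poly_act scale B g p = p}"

definition poly_subalgebra :: "('x, 'k::comm_ring_1) mpoly set \<Rightarrow> bool" where
  "poly_subalgebra A \<longleftrightarrow> range mconst \<subseteq> A \<and> (\<forall>p\<in>A. \<forall>q\<in>A. p + q \<in> A \<and> p * q \<in> A)"

text \<open>
  For a subring \<open>R\<close> of a ring \<open>A\<close>: \<open>A\<close> has a basis \<open>E\<close> (of any cardinality) as a module over \<open>R\<close>,
  that is, every element of \<open>A\<close> is a unique finite \<open>R\<close>-linear combination of elements of \<open>E\<close>.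
\<close>

definition free_over :: "'a::comm_ring_1 set \<Rightarrow> 'a set \<Rightarrow> bool" where
  "free_over R A \<longleftrightarrow>
     (\<exists>E\<subseteq>A. \<forall>a\<in>A. \<exists>!c :: 'a \<Rightarrow>\<^sub>0 'a.
        Poly_Mapping.keys c \<subseteq> E \<and> range (Poly_Mapping.lookup c) \<subseteq> R \<and>
        a = (\<Sum>e\<in>Poly_Mapping.keys c. Poly_Mapping.lookup c e * e))"

end

theory Submission
  imports Defs
begin

text \<open>
  Write \<open>S = k[V]\<close>, \<open>R = S\<^sup>K\<close> and \<open>A = S\<^bsup>K \<inter> H\<^esup>\<close>. The proof finds a basis of \<open>A\<close> over \<open>R\<close> that lies in
  \<open>S\<^sup>H\<close>, and shows that any such basis is also a basis of \<open>S\<^sup>H\<close> over \<open>S\<^sup>G\<close>.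

  Such a basis exists for reasons of degree. As an algebra \<open>A\<close> is generated by \<open>R\<close> and \<open>S\<^sup>H\<close>, so as an
  \<open>R\<close>-module it is spanned by \<open>S\<^sup>H\<close>. Take homogeneous elements \<open>F\<close> of \<open>S\<^sup>H\<close> whose classes form a
  \<open>k\<close>-basis of \<open>A/R\<^sub>+A\<close>, where \<open>R\<^sub>+\<close> is the ideal of invariants without constant term. By Nakayama's
  lemma for graded modules \<open>F\<close> spans \<open>A\<close> over \<open>R\<close> (\<open>graded_nakayama\<close>). It is independent because \<open>A\<close>
  is free: a splitting of the presentation \<open>R\<^sup>F \<rightarrow> A\<close> makes the module \<open>N\<close> of relations satisfy
  \<open>N = R\<^sub>+N\<close>, and then the coefficients of a relation vanish in every degree (\<open>graded_independence\<close>).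
  The given basis of \<open>A\<close> may be inhomogeneous.

  Now let \<open>h \<in> S\<^sup>H\<close> and write \<open>h = \<Sum>f\<in>F. c\<^sub>f f\<close> with \<open>c\<^sub>f \<in> R\<close>. Every \<open>g \<in> G\<close> is \<open>\<kappa>\<eta>\<close> with \<open>\<kappa> \<in> K\<close>,
  \<open>\<eta> \<in> H\<close>; here \<open>\<eta>\<close> fixes \<open>h\<close> and all \<open>f\<close>, and \<open>\<kappa>\<close> fixes all \<open>c\<^sub>f\<close>, so \<open>g h = \<Sum>f\<in>F. c\<^sub>f (g f)\<close>.
  This system of equations, one for each element of \<open>G\<close>, is permuted by \<open>G\<close>. Hence for each \<open>g\<close> the
  elements \<open>g c\<^sub>f\<close> solve it too. The solution is unique, since the conjugates under \<open>K\<close> of elements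
  independent over \<open>S\<^sup>K\<close> have no common relation over \<open>S\<close> (\<open>conjugates_independent\<close>, from traces and
  Dedekind's independence of characters). So \<open>c\<^sub>f\<close> lies in \<open>S\<^sup>G\<close> (\<open>basis_descends\<close>).
\<close>

section \<open>Substitution into polynomials\<close>

lemma poly_mapping_additive_induct [case_names zero single add]:
  fixes p :: "'a \<Rightarrow>\<^sub>0 'b::comm_monoid_add"
  assumes "P 0" "\<And>m c. P (Poly_Mapping.single m c)" "\<And>p q. P p \<Longrightarrow> P q \<Longrightarrow> P (p + q)"
  shows "P p"
proof -
  have *: "P (\<Sum>m\<in>M. Poly_Mapping.single m (Poly_Mapping.lookup p m))" if "finite M" for M
    using that by (induction M) (auto intro: assms)
  have "p = (\<Sum>m\<in>Poly_Mapping.keys p. Poly_Mapping.single m (Poly_Mapping.lookup p m))"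
    by (rule poly_mapping_eqI)
      (auto simp: lookup_sum lookup_single when_def in_keys_iff sum.delta'[OF finite_keys])
  then show ?thesis using *[of "Poly_Mapping.keys p"] by simp
qed

lemma mconst_simps [simp]:
  "mconst 0 = 0" "mconst 1 = 1" "mconst (a + b) = mconst a + mconst b"
  "mconst (- c) = - mconst (c::'k::comm_ring_1)" "mconst (c * d) = mconst c * mconst d"
  by (simp_all add: mconst_def single_add single_uminus mult_single)

lemma mconst_sum: "mconst (\<Sum>i\<in>I. f i) = (\<Sum>i\<in>I. mconst (f i))"
  by (induction I rule: infinite_finite_induct) auto

lemma lookup_mconst_mult: "Poly_Mapping.lookup (mconst c * p) m = c * Poly_Mapping.lookup p m"
  for c :: "'k::comm_ring_1" and p :: "('x, 'k) mpoly"
proof (induction p rule: poly_mapping_additive_induct)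
  case (single m c)
  then show ?case by (simp add: mconst_def mult_single lookup_single when_def)
qed (auto simp: algebra_simps lookup_add)

definition monomial_value :: "('x \<Rightarrow> ('y, 'k) mpoly) \<Rightarrow> ('x \<Rightarrow>\<^sub>0 nat) \<Rightarrow> ('y, 'k::comm_ring_1) mpoly" where
  "monomial_value \<sigma> m = (\<Prod>x\<in>Poly_Mapping.keys m. \<sigma> x ^ Poly_Mapping.lookup m x)"

lemma monomial_value_superset:
  assumes "finite X" "Poly_Mapping.keys m \<subseteq> X"
  shows "monomial_value \<sigma> m = (\<Prod>x\<in>X. \<sigma> x ^ Poly_Mapping.lookup m x)"
  unfolding monomial_value_def using assms by (intro prod.mono_neutral_left) (auto simp: in_keys_iff)

lemma monomial_value_zero [simp]: "monomial_value \<sigma> 0 = 1"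
  by (simp add: monomial_value_def)

lemma monomial_value_add: "monomial_value \<sigma> (m + n) = monomial_value \<sigma> m * monomial_value \<sigma> n"
proof -
  let ?X = "Poly_Mapping.keys m \<union> Poly_Mapping.keys n"
  have "Poly_Mapping.keys (m + n) \<subseteq> ?X" by (rule keys_add)
  then show ?thesis
    by (simp add: monomial_value_superset[of ?X] lookup_add power_add prod.distrib)
qed

lemma msubst_superset:
  assumes "finite M" "Poly_Mapping.keys p \<subseteq> M"
  shows "msubst \<sigma> p = (\<Sum>m\<in>M. mconst (Poly_Mapping.lookup p m) * monomial_value \<sigma> m)"
  unfolding msubst_def monomial_value_def[symmetric] using assms
  by (intro sum.mono_neutral_left) (auto simp: in_keys_iff)

lemma msubst_zero [simp]: "msubst \<sigma> 0 = 0"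
  by (simp add: msubst_def)

lemma msubst_single: "msubst \<sigma> (Poly_Mapping.single m c) = mconst c * monomial_value \<sigma> m"
  by (subst msubst_superset[of "{m}"]) auto

lemma msubst_add: "msubst \<sigma> (p + q) = msubst \<sigma> p + msubst \<sigma> q"
proof -
  let ?M = "Poly_Mapping.keys p \<union> Poly_Mapping.keys q"
  have "Poly_Mapping.keys (p + q) \<subseteq> ?M" by (rule keys_add)
  then show ?thesis
    by (simp add: msubst_superset[of ?M] lookup_add sum.distrib distrib_right)
qed

lemma msubst_sum: "msubst \<sigma> (\<Sum>i\<in>I. f i) = (\<Sum>i\<in>I. msubst \<sigma> (f i))"
  by (induction I rule: infinite_finite_induct) (auto simp: msubst_add)

lemma msubst_mult: "msubst \<sigma> (p * q) = msubst \<sigma> p * msubst \<sigma> q"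
proof (induction p rule: poly_mapping_additive_induct)
  case (single m c)
  show ?case
    by (induction q rule: poly_mapping_additive_induct)
      (simp_all add: mult_single msubst_single monomial_value_add algebra_simps msubst_add)
qed (auto simp: algebra_simps msubst_add)

lemma msubst_mconst [simp]: "msubst \<sigma> (mconst c) = mconst c"
  unfolding mconst_def by (subst msubst_single) (simp add: mconst_def)

lemma msubst_one [simp]: "msubst \<sigma> 1 = 1"
  using msubst_mconst[of \<sigma> 1] by simp

lemma msubst_power: "msubst \<sigma> (p ^ n) = msubst \<sigma> p ^ n"
  by (induction n) (simp_all add: msubst_mult)

lemma msubst_prod: "msubst \<sigma> (\<Prod>i\<in>I. f i) = (\<Prod>i\<in>I. msubst \<sigma> (f i))"
  by (induction I rule: infinite_finite_induct) (auto simp: msubst_mult)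

lemma msubst_mvar [simp]: "msubst \<sigma> (mvar x) = \<sigma> x"
  unfolding mvar_def by (simp add: msubst_single monomial_value_def)

lemma msubst_msubst: "msubst \<tau> (msubst \<sigma> p) = msubst (\<lambda>x. msubst \<tau> (\<sigma> x)) p"
  by (simp add: msubst_def[of \<sigma>] msubst_def[of "\<lambda>x. msubst \<tau> (\<sigma> x)"]
      msubst_sum msubst_mult msubst_prod msubst_power)

lemma single_eq_monomial_value: "Poly_Mapping.single m 1 = monomial_value mvar m"
proof -
  have pow: "mvar x ^ n = Poly_Mapping.single (Poly_Mapping.single x n) 1" for x :: 'a and n
    by (induction n) (simp_all add: mvar_def mult_single single_add[symmetric] del: single_one,
        simp)
  have prod: "(\<Prod>x\<in>X. Poly_Mapping.single (f x) 1) = Poly_Mapping.single (sum f X) (1::'b)"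
    if "finite X" for X and f :: "'a \<Rightarrow> 'a \<Rightarrow>\<^sub>0 nat"
    using that by (induction X) (simp_all add: mult_single del: single_one, simp)
  have "m = (\<Sum>x\<in>Poly_Mapping.keys m. Poly_Mapping.single x (Poly_Mapping.lookup m x))"
    by (rule poly_mapping_eqI)
      (auto simp: lookup_sum lookup_single when_def in_keys_iff sum.delta'[OF finite_keys])
  then show ?thesis by (simp add: monomial_value_def pow prod del: single_one)
qed

lemma msubst_mvar_id: "msubst mvar p = p"
proof (induction p rule: poly_mapping_additive_induct)
  case (single m c)
  then show ?case
    by (simp add: msubst_single single_eq_monomial_value[symmetric] mconst_def mult_single)
qed (auto simp: msubst_add)

lemma msubst_cong_coord_ring:
  assumes "p \<in> coord_ring B" "\<And>b. b \<in> B \<Longrightarrow> \<sigma> b = \<tau> b"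
  shows "msubst \<sigma> p = msubst \<tau> p"
  unfolding msubst_def using assms
  by (intro sum.cong arg_cong2[where f = "(*)"] prod.cong) (auto simp: coord_ring_def subset_iff)

text \<open>
  A linear order on the variables gives an ordered monoid of monomials, for which leading monomials
  multiply. The variables here carry no order, but finitely many of them can be renamed by natural
  numbers, and renaming back is a left inverse.
\<close>

lemma coord_ring_no_zero_divisors:
  fixes p q :: "('v, 'k::field) mpoly"
  assumes "finite B" "p \<in> coord_ring B" "q \<in> coord_ring B" "p * q = 0"
  shows "p = 0 \<or> q = 0"
proof -
  obtain \<iota> :: "'v \<Rightarrow> nat" where \<iota>: "inj_on \<iota> B"
    using finite_imp_inj_to_nat_seg[OF \<open>finite B\<close>] by blast
  define \<rho> :: "('v, 'k) mpoly \<Rightarrow> (nat, 'k) mpoly" where "\<rho> = msubst (\<lambda>x. mvar (\<iota> x))"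
  define \<rho>' :: "(nat, 'k) mpoly \<Rightarrow> ('v, 'k) mpoly" where "\<rho>' = msubst (\<lambda>n. mvar (inv_into B \<iota> n))"
  have id: "\<rho>' (\<rho> r) = r" if "r \<in> coord_ring B" for r
  proof -
    have "\<rho>' (\<rho> r) = msubst mvar r"
      unfolding \<rho>_def \<rho>'_def msubst_msubst
      by (rule msubst_cong_coord_ring[OF that]) (simp add: \<iota>)
    then show ?thesis by (simp add: msubst_mvar_id)
  qed
  have "\<rho> p * \<rho> q = 0" using assms(4) by (simp add: \<rho>_def msubst_mult[symmetric])
  then have "\<rho> p = 0 \<or> \<rho> q = 0" by simp
  then show ?thesis using id[OF assms(2)] id[OF assms(3)] by (auto simp: \<rho>'_def)
qed

section \<open>The grading by total degree\<close>

definition total_degree :: "('x \<Rightarrow>\<^sub>0 nat) \<Rightarrow> nat" where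
  "total_degree m = (\<Sum>x\<in>Poly_Mapping.keys m. Poly_Mapping.lookup m x)"

lemma total_degree_superset:
  assumes "finite X" "Poly_Mapping.keys m \<subseteq> X"
  shows "total_degree m = (\<Sum>x\<in>X. Poly_Mapping.lookup m x)"
  unfolding total_degree_def using assms by (intro sum.mono_neutral_left) (auto simp: in_keys_iff)

lemma total_degree_add: "total_degree (m + n) = total_degree m + total_degree n"
proof -
  let ?X = "Poly_Mapping.keys m \<union> Poly_Mapping.keys n"
  have "Poly_Mapping.keys (m + n) \<subseteq> ?X" by (rule keys_add)
  then show ?thesis by (simp add: total_degree_superset[of ?X] lookup_add sum.distrib)
qed

lemma total_degree_eq_0_iff [simp]: "total_degree m = 0 \<longleftrightarrow> m = 0"
  by (auto simp: total_degree_def in_keys_iff intro!: poly_mapping_eqI)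

definition hom_part :: "nat \<Rightarrow> ('x, 'k) mpoly \<Rightarrow> ('x, 'k::comm_ring_1) mpoly" where
  "hom_part d p = Poly_Mapping.mapp (\<lambda>m c. c when total_degree m = d) p"

lemma lookup_hom_part: "Poly_Mapping.lookup (hom_part d p) m = (Poly_Mapping.lookup p m when total_degree m = d)"
  by (auto simp: hom_part_def lookup_mapp when_def in_keys_iff)

lemma hom_part_zero [simp]: "hom_part d 0 = 0"
  by (rule poly_mapping_eqI) (simp add: lookup_hom_part)

lemma hom_part_add: "hom_part d (p + q) = hom_part d p + hom_part d q"
  by (rule poly_mapping_eqI) (simp add: lookup_hom_part lookup_add when_def)

lemma hom_part_sum: "hom_part d (\<Sum>i\<in>I. f i) = (\<Sum>i\<in>I. hom_part d (f i))"
  by (induction I rule: infinite_finite_induct) (auto simp: hom_part_add)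

lemma hom_part_mconst_mult: "hom_part d (mconst c * p) = mconst c * hom_part d p"
  by (rule poly_mapping_eqI) (simp add: lookup_hom_part lookup_mconst_mult when_def)

lemma hom_part_hom_part: "hom_part d (hom_part e p) = (hom_part d p when d = e)"
  by (rule poly_mapping_eqI) (auto simp: lookup_hom_part when_def)

lemma hom_part_0: "hom_part 0 p = mconst (Poly_Mapping.lookup p 0)"
  by (rule poly_mapping_eqI) (auto simp: lookup_hom_part mconst_def lookup_single when_def)

lemma hom_part_single:
  "hom_part d (Poly_Mapping.single m c) = (Poly_Mapping.single m c when total_degree m = d)"
  by (rule poly_mapping_eqI) (auto simp: lookup_hom_part lookup_single when_def)

lemma hom_part_mult: "hom_part d (p * q) = (\<Sum>e\<le>d. hom_part e p * hom_part (d - e) q)"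
proof (induction p rule: poly_mapping_additive_induct)
  case (single m c)
  show ?case
  proof (induction q rule: poly_mapping_additive_induct)
    case (single n c')
    have "(\<Sum>e\<le>d. hom_part e (Poly_Mapping.single m c) * hom_part (d - e) (Poly_Mapping.single n c')) =
        (\<Sum>e\<le>d. if e = total_degree m then Poly_Mapping.single (m + n) (c * c') when total_degree n = d - e else 0)"
      by (intro sum.cong) (auto simp: hom_part_single mult_single when_def)
    also have "\<dots> = hom_part d (Poly_Mapping.single m c * Poly_Mapping.single n c')"
      by (auto simp: mult_single hom_part_single total_degree_add when_def)
    finally show ?case ..
  qed (simp_all add: hom_part_add distrib_left sum.distrib)
qed (simp_all add: hom_part_add distrib_right sum.distrib)

lemma sum_hom_part:
  assumes "finite D" "total_degree ` Poly_Mapping.keys p \<subseteq> D"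
  shows "(\<Sum>d\<in>D. hom_part d p) = p"
proof (rule poly_mapping_eqI)
  fix m
  have "total_degree m \<in> D" if "Poly_Mapping.lookup p m \<noteq> 0"
    using assms that by (auto simp: in_keys_iff)
  then show "Poly_Mapping.lookup (\<Sum>d\<in>D. hom_part d p) m = Poly_Mapping.lookup p m"
    using assms by (auto simp: lookup_sum lookup_hom_part when_def)
qed

lemma hom_part_eq_0_imp: "(\<And>d. hom_part d p = 0) \<Longrightarrow> p = 0"
  using sum_hom_part[of "total_degree ` Poly_Mapping.keys p" p] by simp

definition graded :: "('x, 'k::comm_ring_1) mpoly set \<Rightarrow> bool" where
  "graded A \<longleftrightarrow> (\<forall>p\<in>A. \<forall>d. hom_part d p \<in> A)"

interpretation mpoly: vector_space "\<lambda>(c::'k::field) (p::('x, 'k) mpoly). mconst c * p"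
  by unfold_locales (simp_all add: algebra_simps)

lemma poly_subalgebra_closed:
  assumes "poly_subalgebra A"
  shows "mconst c \<in> A" "0 \<in> A" "1 \<in> A"
    and "p \<in> A \<Longrightarrow> q \<in> A \<Longrightarrow> p + q \<in> A" "p \<in> A \<Longrightarrow> q \<in> A \<Longrightarrow> p * q \<in> A"
    and "p \<in> A \<Longrightarrow> - p \<in> A" "p \<in> A \<Longrightarrow> q \<in> A \<Longrightarrow> p - q \<in> A"
    and "(\<And>i. i \<in> I \<Longrightarrow> f i \<in> A) \<Longrightarrow> sum f I \<in> A"
proof -
  have const: "mconst c \<in> A" for c using assms by (auto simp: poly_subalgebra_def)
  have add: "p + q \<in> A" and mult: "p * q \<in> A" if "p \<in> A" "q \<in> A" for p q
    using assms that by (auto simp: poly_subalgebra_def)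
  have uminus: "- p \<in> A" if "p \<in> A" for p
    using mult[OF const[of "-1"] that] by simp
  show "mconst c \<in> A" "0 \<in> A" "1 \<in> A"
    using const[of c] const[of 0] const[of 1] by simp_all
  show "p \<in> A \<Longrightarrow> q \<in> A \<Longrightarrow> p + q \<in> A" "p \<in> A \<Longrightarrow> q \<in> A \<Longrightarrow> p * q \<in> A" "p \<in> A \<Longrightarrow> - p \<in> A"
    by (fact add mult uminus)+
  show "p \<in> A \<Longrightarrow> q \<in> A \<Longrightarrow> p - q \<in> A"
    using add[OF _ uminus] by fastforce
  show "(\<And>i. i \<in> I \<Longrightarrow> f i \<in> A) \<Longrightarrow> sum f I \<in> A"
    using const[of 0] by (induction I rule: infinite_finite_induct) (auto intro: add)
qed

section \<open>Bases of modules over a subring\<close>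

definition combinations :: "'a::comm_ring_1 set \<Rightarrow> 'a set \<Rightarrow> 'a set" where
  "combinations R E =
     {a. \<exists>T c. finite T \<and> T \<subseteq> E \<and> c ` T \<subseteq> R \<and> a = (\<Sum>e\<in>T. c e * e)}"

lemma combinationsI:
  "finite T \<Longrightarrow> T \<subseteq> E \<Longrightarrow> c ` T \<subseteq> R \<Longrightarrow> a = (\<Sum>e\<in>T. c e * e) \<Longrightarrow> a \<in> combinations R E"
  unfolding combinations_def by (intro CollectI exI conjI)

lemma combinationsE:
  assumes "a \<in> combinations R E"
  obtains T c where "finite T" "T \<subseteq> E" "c ` T \<subseteq> R" "a = (\<Sum>e\<in>T. c e * e)"
  using assms unfolding combinations_def by (elim CollectE exE conjE) (rule that)

lemma common_combination:
  assumes "0 \<in> R" "finite I" "v ` I \<subseteq> combinations R E" "finite T0" "T0 \<subseteq> E"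
  obtains T c where "finite T" "T0 \<subseteq> T" "T \<subseteq> E" "\<forall>i\<in>I. \<forall>e. c i e \<in> R"
    "\<forall>i\<in>I. v i = (\<Sum>e\<in>T. c i e * e)"
proof -
  have "\<forall>i\<in>I. \<exists>Tc. finite (fst Tc) \<and> fst Tc \<subseteq> E \<and> snd Tc ` fst Tc \<subseteq> R \<and>
      v i = (\<Sum>e\<in>fst Tc. snd Tc e * e)"
  proof
    fix i assume "i \<in> I"
    then have "v i \<in> combinations R E" using assms(3) by auto
    then obtain T c where "finite T" "T \<subseteq> E" "c ` T \<subseteq> R" "v i = (\<Sum>e\<in>T. c e * e)"
      by (rule combinationsE)
    then show "\<exists>Tc. finite (fst Tc) \<and> fst Tc \<subseteq> E \<and> snd Tc ` fst Tc \<subseteq> R \<and>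
        v i = (\<Sum>e\<in>fst Tc. snd Tc e * e)"
      by (intro exI[of _ "(T, c)"]) simp
  qed
  from bchoice[OF this] obtain Tc where
    Tc0: "\<forall>i\<in>I. finite (fst (Tc i)) \<and> fst (Tc i) \<subseteq> E \<and> snd (Tc i) ` fst (Tc i) \<subseteq> R \<and>
      v i = (\<Sum>e\<in>fst (Tc i). snd (Tc i) e * e)" ..
  define T where "T i = fst (Tc i)" for i
  define c where "c i = snd (Tc i)" for i
  have Tc: "finite (T i)" "T i \<subseteq> E" "c i ` T i \<subseteq> R" "v i = (\<Sum>e\<in>T i. c i e * e)" if "i \<in> I" for i
    using bspec[OF Tc0 that] by (simp_all add: T_def c_def)
  define T' where "T' = T0 \<union> (\<Union>i\<in>I. T i)"
  define c' where "c' i e = (if e \<in> T i then c i e else 0)" for i e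
  have T': "finite T'" "T0 \<subseteq> T'" "T' \<subseteq> E"
    using Tc(1,2) assms by (auto simp: T'_def)
  show ?thesis
  proof (rule that[OF T'])
    show "\<forall>i\<in>I. \<forall>e. c' i e \<in> R"
      using Tc(3) assms(1) by (auto simp: c'_def)
    show "\<forall>i\<in>I. v i = (\<Sum>e\<in>T'. c' i e * e)"
    proof
      fix i assume i: "i \<in> I"
      have "(\<Sum>e\<in>T i. c i e * e) = (\<Sum>e\<in>T'. c' i e * e)"
        using i T'(1) by (intro sum.mono_neutral_cong_left) (auto simp: T'_def c'_def)
      then show "v i = (\<Sum>e\<in>T'. c' i e * e)"
        using Tc(4)[OF i] by simp
    qed
  qed
qed

text \<open>
  Coefficients are plain functions on a finite set, and zero coefficients are allowed, so that several
  elements can be expanded over one common finite subset of the basis.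
\<close>

definition module_basis :: "'a::comm_ring_1 set \<Rightarrow> 'a set \<Rightarrow> 'a set \<Rightarrow> bool" where
  "module_basis R A E \<longleftrightarrow> E \<subseteq> A \<and> A \<subseteq> combinations R E \<and>
     (\<forall>T c. finite T \<longrightarrow> T \<subseteq> E \<longrightarrow> c ` T \<subseteq> R \<longrightarrow> (\<Sum>e\<in>T. c e * e) = 0 \<longrightarrow> (\<forall>e\<in>T. c e = 0))"

lemma module_basis_subset: "module_basis R A E \<Longrightarrow> E \<subseteq> A"
  and module_basis_combinations: "module_basis R A E \<Longrightarrow> A \<subseteq> combinations R E"
  by (simp_all add: module_basis_def)

lemma module_basis_independent:
  assumes "module_basis R A E" "finite T" "T \<subseteq> E" "\<And>e. e \<in> T \<Longrightarrow> c e \<in> R"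
    and "(\<Sum>e\<in>T. c e * e) = 0" "e \<in> T"
  shows "c e = 0"
proof -
  have ind: "\<forall>T c. finite T \<longrightarrow> T \<subseteq> E \<longrightarrow> c ` T \<subseteq> R \<longrightarrow> (\<Sum>e\<in>T. c e * e) = 0 \<longrightarrow> (\<forall>e\<in>T. c e = 0)"
    using assms(1) unfolding module_basis_def by (elim conjE)
  have "c ` T \<subseteq> R" using assms(4) by auto
  from ind[rule_format, OF assms(2,3) this assms(5,6)] show ?thesis .
qed

lemma free_over_iff_module_basis:
  fixes R A :: "'a::comm_ring_1 set"
  assumes "0 \<in> A" "0 \<in> R" "\<And>x y. x \<in> R \<Longrightarrow> y \<in> R \<Longrightarrow> x - y \<in> R"
  shows "free_over R A \<longleftrightarrow> (\<exists>E. module_basis R A E)"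
proof -
  let ?lin = "\<lambda>c :: 'a \<Rightarrow>\<^sub>0 'a. \<Sum>e\<in>Poly_Mapping.keys c. Poly_Mapping.lookup c e * e"
  have lin: "?lin c = (\<Sum>e\<in>T. Poly_Mapping.lookup c e * e)"
    if "finite T" "Poly_Mapping.keys c \<subseteq> T" for c T
    using that by (intro sum.mono_neutral_left) (auto simp: in_keys_iff)
  have restrict: "\<exists>c'. Poly_Mapping.keys c' \<subseteq> T \<and> range (Poly_Mapping.lookup c') \<subseteq> R \<and>
      (\<forall>e\<in>T. Poly_Mapping.lookup c' e = c e) \<and> ?lin c' = (\<Sum>e\<in>T. c e * e)"
    if T: "finite T" "c ` T \<subseteq> R" for c T
  proof -
    have "finite {e. (c e when e \<in> T) \<noteq> 0}"
      by (rule finite_subset[OF _ \<open>finite T\<close>]) auto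
    from lookup_Abs_poly_mapping[OF this]
    obtain c' where c': "Poly_Mapping.lookup c' = (\<lambda>e. c e when e \<in> T)"
      by (rule that)
    have keys: "Poly_Mapping.keys c' \<subseteq> T" by (auto simp: in_keys_iff c')
    have "?lin c' = (\<Sum>e\<in>T. c e * e)"
      by (subst lin[OF T(1) keys]) (simp add: c')
    then show ?thesis
      using T(2) assms(2) keys by (intro exI[of _ c']) (auto simp: c' when_def)
  qed
  have unique: "x = y" if "\<exists>!x. P x" "P x" "P y" for P and x y :: "'a \<Rightarrow>\<^sub>0 'a"
    using that by blast
  show ?thesis
  proof
    assume "free_over R A"
    then obtain E where E: "E \<subseteq> A" and "\<forall>a\<in>A. \<exists>!c :: 'a \<Rightarrow>\<^sub>0 'a.
        Poly_Mapping.keys c \<subseteq> E \<and> range (Poly_Mapping.lookup c) \<subseteq> R \<and> a = ?lin c"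
      unfolding free_over_def by (elim exE conjE) (rule that)
    note ex = bspec[OF this(2)]
    have "module_basis R A E"
      unfolding module_basis_def
    proof (intro conjI ballI allI impI subsetI)
      show "e \<in> A" if "e \<in> E" for e using E that by auto
    next
      fix a assume "a \<in> A"
      from ex1_implies_ex[OF ex[OF this]] obtain c :: "'a \<Rightarrow>\<^sub>0 'a"
        where "Poly_Mapping.keys c \<subseteq> E" "range (Poly_Mapping.lookup c) \<subseteq> R" "a = ?lin c"
        by (elim exE conjE) (rule that)
      then show "a \<in> combinations R E"
        by (intro combinationsI[of "Poly_Mapping.keys c" E "Poly_Mapping.lookup c"]) auto
    next
      fix T c e0
      assume T: "finite T" "T \<subseteq> E" "c ` T \<subseteq> R" and 0: "(\<Sum>e\<in>T. c e * e) = 0" and e0: "e0 \<in> T"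
      from restrict[OF T(1,3)] obtain c'
        where c': "Poly_Mapping.keys c' \<subseteq> T" "range (Poly_Mapping.lookup c') \<subseteq> R"
          "\<forall>e\<in>T. Poly_Mapping.lookup c' e = c e" "?lin c' = (\<Sum>e\<in>T. c e * e)"
        by (elim exE conjE) (rule that)
      have "c' = 0"
        by (rule unique[OF ex[OF assms(1)]]) (use c' T(2) 0 assms(2) in auto)
      then show "c e0 = 0" using c'(3) e0 by auto
    qed
    then show "\<exists>E. module_basis R A E" ..
  next
    assume "\<exists>E. module_basis R A E"
    then obtain E where E: "module_basis R A E" ..
    show "free_over R A"
      unfolding free_over_def
    proof (intro exI[of _ E] conjI ballI ex_ex1I)
      show "E \<subseteq> A" using module_basis_subset[OF E] .
    next
      fix a assume "a \<in> A"
      then have "a \<in> combinations R E" using module_basis_combinations[OF E] by auto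
      then obtain T c where T: "finite T" "T \<subseteq> E" "c ` T \<subseteq> R" "a = (\<Sum>e\<in>T. c e * e)"
        by (rule combinationsE)
      from restrict[OF T(1,3)] obtain c'
        where "Poly_Mapping.keys c' \<subseteq> T" "range (Poly_Mapping.lookup c') \<subseteq> R"
          "?lin c' = (\<Sum>e\<in>T. c e * e)"
        by (elim exE conjE) (rule that)
      then show "\<exists>c :: 'a \<Rightarrow>\<^sub>0 'a. Poly_Mapping.keys c \<subseteq> E \<and> range (Poly_Mapping.lookup c) \<subseteq> R \<and>
          a = ?lin c"
        using T by (intro exI[of _ c']) auto
    next
      fix a and c d :: "'a \<Rightarrow>\<^sub>0 'a"
      assume c: "Poly_Mapping.keys c \<subseteq> E \<and> range (Poly_Mapping.lookup c) \<subseteq> R \<and> a = ?lin c"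
        and d: "Poly_Mapping.keys d \<subseteq> E \<and> range (Poly_Mapping.lookup d) \<subseteq> R \<and> a = ?lin d"
      let ?T = "Poly_Mapping.keys c \<union> Poly_Mapping.keys d"
      have "(\<Sum>e\<in>?T. Poly_Mapping.lookup c e * e) = (\<Sum>e\<in>?T. Poly_Mapping.lookup d e * e)"
        using c d lin[of ?T c] lin[of ?T d] by simp
      then have 0: "(\<Sum>e\<in>?T. (Poly_Mapping.lookup c e - Poly_Mapping.lookup d e) * e) = 0"
        by (simp add: left_diff_distrib sum_subtractf)
      have "Poly_Mapping.lookup c e - Poly_Mapping.lookup d e = 0" if "e \<in> ?T" for e
        by (rule module_basis_independent[OF E _ _ _ 0 that]) (use c d in \<open>auto intro!: assms(3)\<close>)
      then show "c = d"
        by (intro poly_mapping_eqI) (metis Un_iff eq_iff_diff_eq_0 in_keys_iff)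
    qed
  qed
qed

section \<open>A homogeneous basis inside a generating set\<close>

lemma hom_part_span_subset:
  fixes X M :: "('x, 'k::field) mpoly set"
  assumes "mpoly.subspace M" "\<And>x. x \<in> X \<Longrightarrow> hom_part d x \<in> M" "p \<in> mpoly.span X"
  shows "hom_part d p \<in> M"
proof -
  have "mpoly.span X \<subseteq> {p. hom_part d p \<in> M}"
    using assms(1,2)
    by (intro mpoly.span_minimal) (auto simp: mpoly.subspace_def hom_part_add hom_part_mconst_mult)
  then show ?thesis using assms(3) by blast
qed

text \<open>
  For a subalgebra \<open>R\<close> this is the \<open>R\<close>-module generated by \<open>X\<close>. The form as a \<open>k\<close>-linear span makes
  linear algebra over the field applicable.
\<close>

definition module_span :: "('x, 'k::field) mpoly set \<Rightarrow> ('x, 'k) mpoly set \<Rightarrow> ('x, 'k) mpoly set" where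
  "module_span R X = mpoly.span {r * x | r x. r \<in> R \<and> x \<in> X}"

lemma module_span_base: "r \<in> R \<Longrightarrow> x \<in> X \<Longrightarrow> r * x \<in> module_span R X"
  unfolding module_span_def by (rule mpoly.span_base) blast

lemma module_span_subspace: "mpoly.subspace (module_span R X)"
  unfolding module_span_def by (rule mpoly.subspace_span)

lemma module_span_minimal:
  assumes "mpoly.subspace M" "\<And>r x. r \<in> R \<Longrightarrow> x \<in> X \<Longrightarrow> r * x \<in> M"
  shows "module_span R X \<subseteq> M"
  unfolding module_span_def using assms by (intro mpoly.span_minimal) auto

lemma module_span_mult:
  assumes "poly_subalgebra R" "r \<in> R" "p \<in> module_span R X"
  shows "r * p \<in> module_span R X"
proof -
  have "module_span R X \<subseteq> {p. r * p \<in> module_span R X}"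
  proof (rule module_span_minimal)
    show "mpoly.subspace {p. r * p \<in> module_span R X}"
      using module_span_subspace[of R X]
      by (simp add: mpoly.subspace_def distrib_left mult.left_commute[of r])
    show "s * x \<in> {p. r * p \<in> module_span R X}" if "s \<in> R" "x \<in> X" for s x
      using module_span_base[of "r * s" R x X] that assms(1,2)
      by (simp add: poly_subalgebra_closed mult.assoc)
  qed
  then show ?thesis using assms(3) by blast
qed

text \<open>
  Since \<open>(r x) (r' x') = (r r') (x x')\<close>, the span of the products is already closed under
  multiplication; an algebra generated by two subalgebras is therefore spanned by one of them as a
  module over the other.
\<close>

lemma poly_subalgebra_module_span:
  fixes R X :: "('x, 'k::field) mpoly set"
  assumes R: "poly_subalgebra R" and X: "poly_subalgebra X"
  shows "poly_subalgebra (module_span R X)"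
  unfolding poly_subalgebra_def
proof (intro conjI ballI)
  let ?M = "module_span R X"
  note M = module_span_subspace[of R X]
  show "range mconst \<subseteq> ?M"
    using module_span_base[OF poly_subalgebra_closed(1)[OF R] poly_subalgebra_closed(3)[OF X]] by auto
  fix p q assume p: "p \<in> ?M" and q: "q \<in> ?M"
  show "p + q \<in> ?M" using p q by (rule mpoly.subspace_add[OF M])
  have mult_X: "x * p \<in> ?M" if "x \<in> X" for x
  proof -
    have "?M \<subseteq> {p. x * p \<in> ?M}"
    proof (rule module_span_minimal)
      show "mpoly.subspace {p. x * p \<in> ?M}"
        using M by (simp add: mpoly.subspace_def distrib_left mult.left_commute[of x])
      show "r * y \<in> {p. x * p \<in> ?M}" if "r \<in> R" "y \<in> X" for r y
        using module_span_base[OF that(1) poly_subalgebra_closed(5)[OF X \<open>x \<in> X\<close> that(2)]]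
        by (simp add: mult.left_commute[of x])
    qed
    then show ?thesis using p by blast
  qed
  have "?M \<subseteq> {q. p * q \<in> ?M}"
  proof (rule module_span_minimal)
    show "mpoly.subspace {q. p * q \<in> ?M}"
      using M by (simp add: mpoly.subspace_def distrib_left mult.left_commute[of p])
    show "r * x \<in> {q. p * q \<in> ?M}" if "r \<in> R" "x \<in> X" for r x
      using module_span_mult[OF R that(1) mult_X[OF that(2)]] by (simp add: mult_ac)
  qed
  then show "p * q \<in> ?M" using q by blast
qed

lemma hull_subset_module_span:
  assumes R: "poly_subalgebra R" and X: "poly_subalgebra X"
  shows "poly_subalgebra hull (R \<union> X) \<subseteq> module_span R X"
proof (rule hull_minimal)
  show "R \<union> X \<subseteq> module_span R X"
    using module_span_base[of _ R 1 X] module_span_base[of 1 R _ X]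
      poly_subalgebra_closed(3)[OF R] poly_subalgebra_closed(3)[OF X] by auto
qed (rule poly_subalgebra_module_span[OF assms])

lemma module_span_subset_combinations:
  assumes R: "poly_subalgebra R"
  shows "module_span R X \<subseteq> combinations R X"
proof (rule module_span_minimal)
  note closed = poly_subalgebra_closed[OF R]
  show "r * x \<in> combinations R X" if "r \<in> R" "x \<in> X" for r x
    by (rule combinationsI[of "{x}" _ "\<lambda>_. r"]) (use that in auto)
  show "mpoly.subspace (combinations R X)"
  proof (rule mpoly.subspaceI)
    show "0 \<in> combinations R X" by (rule combinationsI[of "{}"]) auto
    show "mconst a * q \<in> combinations R X" if q: "q \<in> combinations R X" for a q
    proof -
      obtain T c where T: "finite T" "T \<subseteq> X" "c ` T \<subseteq> R" "q = (\<Sum>x\<in>T. c x * x)"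
        using q by (rule combinationsE)
      have "(\<lambda>x. mconst a * c x) ` T \<subseteq> R" using T(3) by (auto intro!: closed)
      then show ?thesis
        by (rule combinationsI[OF T(1,2)]) (simp add: T(4) sum_distrib_left mult.assoc)
    qed
    show "q + q' \<in> combinations R X" if "q \<in> combinations R X" "q' \<in> combinations R X" for q q'
    proof -
      have fin: "finite {q, q'}" by simp
      have "(\<lambda>i. i) ` {q, q'} \<subseteq> combinations R X" using that by auto
      from common_combination[OF closed(2) fin this finite.emptyI empty_subsetI]
      obtain T c where T: "finite T" "{} \<subseteq> T" "T \<subseteq> X" and c: "\<forall>i\<in>{q, q'}. \<forall>x. c i x \<in> R"
        and q: "\<forall>i\<in>{q, q'}. i = (\<Sum>x\<in>T. c i x * x)"
        .
      have "(\<lambda>x. c q x + c q' x) ` T \<subseteq> R" using c by (auto intro!: closed)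
      moreover have "q + q' = (\<Sum>x\<in>T. (c q x + c q' x) * x)"
        using q by (simp add: distrib_right sum.distrib)
      ultimately show ?thesis by (rule combinationsI[OF T(1,3)])
    qed
  qed
qed

definition augmentation_ideal :: "('x, 'k::zero) mpoly set \<Rightarrow> ('x, 'k) mpoly set" where
  "augmentation_ideal R = {r \<in> R. Poly_Mapping.lookup r 0 = 0}"

text \<open>
  Induction on the degree \<open>d\<close> of a homogeneous element of \<open>A\<close>. In degree \<open>d\<close>, a product \<open>r a\<close> has the
  terms \<open>r\<^sub>e a\<^bsub>d - e\<^esub>\<close>; for \<open>e > 0\<close> the second factor is covered by the induction hypothesis, and for
  \<open>e = 0\<close> the first factor is a constant. So a generator \<open>t\<close> only needs to be reached modulo
  \<open>R\<^sub>+A\<close>. The assumption on \<open>F\<close> says that its elements are homogeneous.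
\<close>

lemma graded_nakayama:
  fixes R A T F :: "('x, 'k::field) mpoly set"
  assumes R: "poly_subalgebra R" "graded R" and A: "poly_subalgebra A" "graded A" "R \<subseteq> A"
    and T: "graded T" "T \<subseteq> A" "A \<subseteq> module_span R T"
    and F: "\<And>f d. f \<in> F \<Longrightarrow> hom_part d f \<in> {0, f}"
    and gen: "\<And>t d. t \<in> T \<Longrightarrow> hom_part d t \<in> mpoly.span (module_span (augmentation_ideal R) A \<union> F)"
  shows "A \<subseteq> module_span R F"
proof
  let ?M = "module_span R F"
  note M = module_span_subspace[of R F]
  have hom: "hom_part d a \<in> ?M" if "a \<in> A" for a d
    using that
  proof (induction d arbitrary: a rule: less_induct)
    case (less d)
    have lower: "hom_part e r * hom_part (d - e) a \<in> ?M" if "r \<in> R" "a \<in> A" "e \<le> d" "e \<noteq> 0" for r a e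
      using that R less.IH[of "d - e" a] by (intro module_span_mult) (auto simp: graded_def)
    have aug: "hom_part d u \<in> ?M" if "u \<in> module_span (augmentation_ideal R) A" for u
    proof (rule hom_part_span_subset[OF M _ that[unfolded module_span_def]], clarify)
      fix r a assume r: "r \<in> augmentation_ideal R" and a: "a \<in> A"
      have "hom_part e r * hom_part (d - e) a \<in> ?M" if "e \<le> d" for e
        using r a that lower[of r a e] mpoly.subspace_0[OF M]
        by (cases "e = 0") (auto simp: hom_part_0 augmentation_ideal_def)
      then show "hom_part d (r * a) \<in> ?M"
        unfolding hom_part_mult by (intro mpoly.subspace_sum[OF M]) auto
    qed
    have gens: "hom_part d t \<in> ?M" if "t \<in> T" for t
    proof -
      have "hom_part d (hom_part d t) \<in> ?M"
      proof (rule hom_part_span_subset[OF M _ gen[OF that]])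
        fix x assume "x \<in> module_span (augmentation_ideal R) A \<union> F"
        then show "hom_part d x \<in> ?M"
        proof
          assume x: "x \<in> F"
          then have "x \<in> ?M"
            using module_span_base[of 1 R x F] R by (simp add: poly_subalgebra_closed)
          then show ?thesis using F[OF x, of d] mpoly.subspace_0[OF M] by auto
        qed (fact aug)
      qed
      then show ?thesis by (simp add: hom_part_hom_part)
    qed
    have "a \<in> mpoly.span {r * x |r x. r \<in> R \<and> x \<in> T}"
      using less.prems T(3) by (auto simp: module_span_def)
    then show ?case
    proof (rule hom_part_span_subset[OF M, rotated], clarify)
      fix r t assume r: "r \<in> R" and t: "t \<in> T"
      have "hom_part e r * hom_part (d - e) t \<in> ?M" if "e \<le> d" for e
      proof (cases "e = 0")
        case True
        then show ?thesis
          using gens[OF t] poly_subalgebra_closed(1)[OF R(1)]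
          by (simp add: hom_part_0 module_span_mult[OF R(1)])
      next
        case False
        then show ?thesis using lower r t T(2) that by blast
      qed
      then show "hom_part d (r * t) \<in> ?M"
        unfolding hom_part_mult by (intro mpoly.subspace_sum[OF M]) auto
    qed
  qed
  fix a assume a: "a \<in> A"
  have "(\<Sum>d\<in>total_degree ` Poly_Mapping.keys a. hom_part d a) \<in> ?M"
    by (intro mpoly.subspace_sum[OF M] hom a)
  then show "a \<in> ?M" by (simp add: sum_hom_part)
qed

text \<open>
  If all coefficients of relations among \<open>F\<close> lack a constant term, then a free module has no nonzero
  relation. Expand \<open>F\<close> in the basis \<open>E\<close>, and \<open>E\<close> in turn in \<open>F\<close>: subtracting from \<open>f\<close> its double
  expansion gives a relation \<open>n\<^sub>f\<close> for each \<open>f\<close>. For a relation \<open>x\<close>, independence of \<open>E\<close> makes the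
  double expansion of \<open>\<Sum>f. x\<^sub>f f\<close> vanish, so \<open>x = \<Sum>f. x\<^sub>f n\<^sub>f\<close>. The \<open>n\<^sub>f\<close> have coefficients of
  positive order, so each \<open>x\<^sub>f\<close> has larger order than the least order among the \<open>x\<^sub>f\<close>.
\<close>

lemma graded_independence:
  fixes R A F E :: "('x, 'k::field) mpoly set"
  assumes R: "poly_subalgebra R" "graded R"
    and E: "module_basis R A E"
    and F: "F \<subseteq> A" "A \<subseteq> module_span R F"
    and rel0: "\<And>T x f. finite T \<Longrightarrow> T \<subseteq> F \<Longrightarrow> x ` T \<subseteq> R \<Longrightarrow> (\<Sum>f\<in>T. x f * f) = 0 \<Longrightarrow>
        f \<in> T \<Longrightarrow> Poly_Mapping.lookup (x f) 0 = 0"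
    and T: "finite T" "T \<subseteq> F" "x ` T \<subseteq> R" "(\<Sum>f\<in>T. x f * f) = 0" "f \<in> T"
  shows "x f = 0"
proof -
  note closed = poly_subalgebra_closed[OF R(1)]
  have "id ` T \<subseteq> combinations R E"
    using T(2) F(1) module_basis_combinations[OF E] by auto
  from common_combination[OF closed(2) T(1) this finite.emptyI empty_subsetI]
  obtain D t where D: "finite D" "{} \<subseteq> D" "D \<subseteq> E" and tR: "\<forall>f\<in>T. \<forall>e. t f e \<in> R"
    and t: "\<forall>f\<in>T. id f = (\<Sum>e\<in>D. t f e * e)" .
  have "id ` D \<subseteq> combinations R F"
    using D(3) module_basis_subset[OF E] F(2)
      module_span_subset_combinations[OF R(1), of F] by (simp add: subset_iff)
  from common_combination[OF closed(2) D(1) this T(1,2)]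
  obtain P s where P: "finite P" "T \<subseteq> P" "P \<subseteq> F" and sR: "\<forall>e\<in>D. \<forall>g. s e g \<in> R"
    and s: "\<forall>e\<in>D. id e = (\<Sum>g\<in>P. s e g * g)" .
  define n where "n f g = (if g = f then 1 else 0) - (\<Sum>e\<in>D. t f e * s e g)" for f g
  have nR: "n f g \<in> R" if "f \<in> T" for f g
    using that tR sR by (auto simp: n_def intro!: closed)
  have n0: "Poly_Mapping.lookup (n f g) 0 = 0" if f: "f \<in> T" and g: "g \<in> P" for f g
  proof (rule rel0[OF P(1,3) _ _ g])
    have "(\<Sum>g\<in>P. n f g * g) = (\<Sum>g\<in>P. (if g = f then g else 0)) -
        (\<Sum>g\<in>P. \<Sum>e\<in>D. t f e * (s e g * g))"
      unfolding sum_subtractf[symmetric]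
      by (intro sum.cong) (auto simp: n_def left_diff_distrib sum_distrib_right mult.assoc)
    also have "\<dots> = f - (\<Sum>e\<in>D. t f e * (\<Sum>g\<in>P. s e g * g))"
      using f P by (subst sum.swap) (auto simp: sum_distrib_left)
    also have "\<dots> = f - (\<Sum>e\<in>D. t f e * e)"
      using s by simp
    finally show "(\<Sum>g\<in>P. n f g * g) = 0" using t f by simp
  qed (use nR[OF f] in auto)
  \<comment> \<open>these are the coordinates of the relation with respect to the basis \<open>E\<close>\<close>
  have xt: "(\<Sum>f\<in>T. x f * t f e) = 0" if e: "e \<in> D" for e
  proof (rule module_basis_independent[OF E D(1,3) _ _ e])
    show "(\<Sum>f\<in>T. x f * t f e) \<in> R" for e
      using T(3) tR by (auto intro!: closed)
    have "(\<Sum>e\<in>D. (\<Sum>f\<in>T. x f * t f e) * e) = (\<Sum>f\<in>T. x f * (\<Sum>e\<in>D. t f e * e))"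
      by (simp add: sum_distrib_left sum_distrib_right mult.assoc) (rule sum.swap)
    also have "\<dots> = (\<Sum>f\<in>T. x f * f)" using t by simp
    finally show "(\<Sum>e\<in>D. (\<Sum>f\<in>T. x f * t f e) * e) = 0" using T(4) by simp
  qed
  have xn: "x g = (\<Sum>f\<in>T. x f * n f g)" if g: "g \<in> T" for g
  proof -
    have "(\<Sum>f\<in>T. x f * n f g) = (\<Sum>f\<in>T. if f = g then x f else 0) -
        (\<Sum>f\<in>T. \<Sum>e\<in>D. x f * t f e * s e g)"
      unfolding sum_subtractf[symmetric]
      by (intro sum.cong) (auto simp: n_def right_diff_distrib sum_distrib_left mult.assoc)
    also have "(\<Sum>f\<in>T. \<Sum>e\<in>D. x f * t f e * s e g) = (\<Sum>e\<in>D. (\<Sum>f\<in>T. x f * t f e) * s e g)"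
      by (subst sum.swap) (simp add: sum_distrib_right)
    also have "\<dots> = 0" using xt by simp
    finally show ?thesis using T(1) g by simp
  qed
  have "hom_part d (x g) = 0" if "g \<in> T" for d g
    using that
  proof (induction d arbitrary: g rule: less_induct)
    case (less d)
    have "hom_part e (x f) * hom_part (d - e) (n f g) = 0" if "f \<in> T" "e \<le> d" for f e
      using less that n0[of f g] P(2) by (cases "e = d") (auto simp: hom_part_0)
    then show ?case
      by (subst xn[OF less.prems]) (simp add: hom_part_sum hom_part_mult)
  qed
  from this[OF T(5)] show ?thesis by (rule hom_part_eq_0_imp)
qed

text \<open>
  \<open>F\<close> is a \<open>k\<close>-basis of the homogeneous elements of \<open>T\<close> modulo \<open>R\<^sub>+A\<close>. The constant terms of a relation
  among \<open>F\<close> over \<open>R\<close> give a linear combination of \<open>F\<close> in \<open>R\<^sub>+A\<close>, so they are zero.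
\<close>

theorem graded_free_basis_in_generators:
  fixes R A T E :: "('x, 'k::field) mpoly set"
  assumes R: "poly_subalgebra R" "graded R" and A: "poly_subalgebra A" "graded A" "R \<subseteq> A"
    and T: "graded T" "T \<subseteq> A" "A \<subseteq> module_span R T"
    and E: "module_basis R A E"
  obtains F where "F \<subseteq> T" "module_basis R A F"
proof -
  let ?U = "module_span (augmentation_ideal R) A"
  let ?H = "{hom_part d t | d t. t \<in> T}"
  \<comment> \<open>what a basis of \<open>R\<^sub>+A\<close> lacks is independent modulo \<open>R\<^sub>+A\<close>\<close>
  obtain U0 where U0: "U0 \<subseteq> ?U" "mpoly.independent U0" "?U \<subseteq> mpoly.span U0"
    using mpoly.maximal_independent_subset[of ?U] by blast
  obtain C where C: "U0 \<subseteq> C" "C \<subseteq> U0 \<union> ?H" "mpoly.independent C" "U0 \<union> ?H \<subseteq> mpoly.span C"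
    using mpoly.maximal_independent_subset_extend[of U0 "U0 \<union> ?H"] U0(2) by blast
  define F where "F = C - U0"
  have FH: "F \<subseteq> ?H" using C(2) by (auto simp: F_def)
  then have FT: "F \<subseteq> T" using T(1) by (auto simp: graded_def)
  have hom: "hom_part d f \<in> {0, f}" if "f \<in> F" for f d
  proof -
    obtain e t where "f = hom_part e t" using FH \<open>f \<in> F\<close> by auto
    then show ?thesis by (simp add: hom_part_hom_part when_def)
  qed
  have "C \<subseteq> ?U \<union> F" using U0(1) by (auto simp: F_def)
  then have span: "hom_part d t \<in> mpoly.span (?U \<union> F)" if "t \<in> T" for t d
    using C(4) that mpoly.span_mono by blast
  have gen: "A \<subseteq> module_span R F"
    by (rule graded_nakayama[OF R A T hom span])
  have rel0: "Poly_Mapping.lookup (x f) 0 = 0"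
    if S: "finite S" "S \<subseteq> F" "x ` S \<subseteq> R" "(\<Sum>f\<in>S. x f * f) = 0" "f \<in> S" for S x f
  proof (rule ccontr)
    let ?c = "\<lambda>f. Poly_Mapping.lookup (x f) 0"
    assume c: "?c f \<noteq> 0"
    have "(x g - mconst (?c g)) * g \<in> ?U" if "g \<in> S" for g
    proof (rule module_span_base)
      show "x g - mconst (?c g) \<in> augmentation_ideal R"
        using that S(3) poly_subalgebra_closed(1,7)[OF R(1)]
        by (simp add: augmentation_ideal_def lookup_minus image_subset_iff) (simp add: mconst_def)
      show "g \<in> A" using that S(2) FT T(2) by auto
    qed
    then have "(\<Sum>g\<in>S. (x g - mconst (?c g)) * g) \<in> ?U"
      by (intro mpoly.subspace_sum module_span_subspace)
    moreover have "(\<Sum>g\<in>S. (x g - mconst (?c g)) * g) = - (\<Sum>g\<in>S. mconst (?c g) * g)"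
      using S(4) by (simp add: left_diff_distrib sum_subtractf)
    ultimately have "- (\<Sum>g\<in>S. mconst (?c g) * g) \<in> mpoly.span (C - {f})"
      using U0(3) S(2,5) mpoly.span_mono[of U0 "C - {f}"] C(1) by (auto simp: F_def)
    moreover have "(\<Sum>g\<in>S - {f}. mconst (?c g) * g) \<in> mpoly.span (C - {f})"
      using S(2) by (intro mpoly.span_sum mpoly.span_scale mpoly.span_base) (auto simp: F_def)
    ultimately have "- (\<Sum>g\<in>S. mconst (?c g) * g) + (\<Sum>g\<in>S - {f}. mconst (?c g) * g)
        \<in> mpoly.span (C - {f})"
      by (rule mpoly.span_add)
    then have "- (mconst (?c f) * f) \<in> mpoly.span (C - {f})"
      by (simp add: sum.remove[OF S(1,5)])
    then have "mconst (- inverse (?c f)) * - (mconst (?c f) * f) \<in> mpoly.span (C - {f})"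
      by (rule mpoly.span_scale)
    moreover have "mconst (- inverse (?c f)) * - (mconst (?c f) * f) = f"
      using c by (simp add: mult.assoc[symmetric] mconst_simps(5)[symmetric] del: mconst_simps(5))
    ultimately show False
      using C(3) S(2,5) by (auto simp: mpoly.dependent_def F_def)
  qed
  have "F \<subseteq> A" using FT T(2) by auto
  have "module_basis R A F"
    unfolding module_basis_def
  proof (intro conjI ballI allI impI)
    show "F \<subseteq> A" by fact
    show "A \<subseteq> combinations R F"
      using gen module_span_subset_combinations[OF R(1)] by blast
    show "c f = 0"
      if "finite S" "S \<subseteq> F" "c ` S \<subseteq> R" "(\<Sum>e\<in>S. c e * e) = 0" "f \<in> S" for S c f
      by (rule graded_independence[OF R E \<open>F \<subseteq> A\<close> gen, where T = S and x = c])
        (fact that | rule rel0, assumption+)+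
  qed
  then show ?thesis using that FT by blast
qed

section \<open>Galois descent of a basis\<close>

text \<open>
  Dedekind's lemma. A relation at \<open>t s\<close> minus \<open>\<chi>\<^sub>j t\<close> times the relation at \<open>s\<close> no longer involves \<open>\<chi>\<^sub>j\<close>,
  and its coefficient at \<open>k\<close> is \<open>a\<^sub>k (\<chi>\<^sub>k t - \<chi>\<^sub>j t)\<close>, where \<open>t\<close> can be chosen to separate \<open>\<chi>\<^sub>k\<close>
  from \<open>\<chi>\<^sub>j\<close>.
\<close>

lemma characters_independent:
  fixes \<chi> :: "'i \<Rightarrow> 'a \<Rightarrow> 'a::comm_ring_1"
  assumes S: "0 \<in> S" "1 \<in> S" "\<And>x y. x \<in> S \<Longrightarrow> y \<in> S \<Longrightarrow> x * y \<in> S" "\<And>x y. x \<in> S \<Longrightarrow> y \<in> S \<Longrightarrow> x - y \<in> S"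
    and domain: "\<And>x y. x \<in> S \<Longrightarrow> y \<in> S \<Longrightarrow> x * y = 0 \<Longrightarrow> x = 0 \<or> y = 0"
    and "finite I"
    and \<chi>: "\<And>i s. i \<in> I \<Longrightarrow> s \<in> S \<Longrightarrow> \<chi> i s \<in> S" "\<And>i. i \<in> I \<Longrightarrow> \<chi> i 1 = 1"
      "\<And>i s t. i \<in> I \<Longrightarrow> s \<in> S \<Longrightarrow> t \<in> S \<Longrightarrow> \<chi> i (s * t) = \<chi> i s * \<chi> i t"
    and distinct: "\<And>i j. i \<in> I \<Longrightarrow> j \<in> I \<Longrightarrow> i \<noteq> j \<Longrightarrow> \<exists>s\<in>S. \<chi> i s \<noteq> \<chi> j s"
    and a: "\<And>i. i \<in> I \<Longrightarrow> a i \<in> S" "\<And>s. s \<in> S \<Longrightarrow> (\<Sum>i\<in>I. a i * \<chi> i s) = 0"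
    and "i \<in> I"
  shows "a i = 0"
  using \<open>finite I\<close> \<chi> distinct a \<open>i \<in> I\<close>
proof (induction I arbitrary: a i)
  case (insert j I)
  have others: "a k = 0" if k: "k \<in> I" for k
  proof -
    obtain t where t: "t \<in> S" "\<chi> k t \<noteq> \<chi> j t"
      using insert.prems(4)[of k j] k insert.hyps(2) by auto
    have "a k * (\<chi> k t - \<chi> j t) = 0"
    proof (rule insert.IH[where a = "\<lambda>i. a i * (\<chi> i t - \<chi> j t)"])
      show "a i * (\<chi> i t - \<chi> j t) \<in> S" if "i \<in> I" for i
        using insert.prems(1,5) t(1) that by (intro S) auto
      show "(\<Sum>i\<in>I. a i * (\<chi> i t - \<chi> j t) * \<chi> i s) = 0" if s: "s \<in> S" for s
      proof -
        have "(\<Sum>i\<in>insert j I. a i * (\<chi> i t - \<chi> j t) * \<chi> i s) =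
            (\<Sum>i\<in>insert j I. a i * \<chi> i (t * s)) - \<chi> j t * (\<Sum>i\<in>insert j I. a i * \<chi> i s)"
          unfolding sum_distrib_left sum_subtractf[symmetric]
          by (intro sum.cong refl) (simp add: insert.prems(3) s t(1) algebra_simps)
        also have "\<dots> = 0"
          using insert.prems(6) s t(1) S(3) by simp
        finally show ?thesis using insert.hyps by simp
      qed
    qed (use insert.prems k in auto)
    moreover have "a k \<in> S" "\<chi> k t - \<chi> j t \<in> S"
      using insert.prems(1,5) k t(1) by (auto intro: S)
    ultimately show ?thesis using domain[of "a k" "\<chi> k t - \<chi> j t"] t(2) by simp
  qed
  have "a j = 0"
    using insert.prems(6)[OF S(2)] insert.prems(2)[of j] insert.hyps others by simp
  then show ?case using others insert.prems(7) by auto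
qed simp

text \<open>
  The domain is a subset \<open>S\<close> of the ring type because a polynomial type has variables for all vectors,
  and only the variables of a basis generate \<open>k[V]\<close>; the action by substitution kills the others.
\<close>

locale finite_domain_action = group M for M :: "'g monoid" (structure) +
  fixes S :: "'a::comm_ring_1 set" and act :: "'g \<Rightarrow> 'a \<Rightarrow> 'a" and G :: "'g set"
  assumes G: "subgroup G M" "finite G"
    and S: "0 \<in> S" "1 \<in> S" "x \<in> S \<Longrightarrow> y \<in> S \<Longrightarrow> x + y \<in> S" "x \<in> S \<Longrightarrow> y \<in> S \<Longrightarrow> x * y \<in> S"
      "x \<in> S \<Longrightarrow> y \<in> S \<Longrightarrow> x - y \<in> S"
    and domain: "x \<in> S \<Longrightarrow> y \<in> S \<Longrightarrow> x * y = 0 \<Longrightarrow> x = 0 \<or> y = 0"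
    and act_closed: "g \<in> G \<Longrightarrow> x \<in> S \<Longrightarrow> act g x \<in> S"
    and act_add: "g \<in> G \<Longrightarrow> x \<in> S \<Longrightarrow> y \<in> S \<Longrightarrow> act g (x + y) = act g x + act g y"
    and act_mult: "g \<in> G \<Longrightarrow> x \<in> S \<Longrightarrow> y \<in> S \<Longrightarrow> act g (x * y) = act g x * act g y"
    and act_1: "g \<in> G \<Longrightarrow> act g 1 = 1"
    and act_one: "x \<in> S \<Longrightarrow> act \<one> x = x"
    and act_act: "g \<in> G \<Longrightarrow> h \<in> G \<Longrightarrow> x \<in> S \<Longrightarrow> act (g \<otimes> h) x = act g (act h x)"
    and faithful: "g \<in> G \<Longrightarrow> h \<in> G \<Longrightarrow> g \<noteq> h \<Longrightarrow> \<exists>x\<in>S. act g x \<noteq> act h x"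
begin

definition fixed_ring :: "'g set \<Rightarrow> 'a set" where
  "fixed_ring L = {x \<in> S. \<forall>g\<in>L. act g x = x}"

lemma act_0: "g \<in> G \<Longrightarrow> act g 0 = 0"
  using act_add[of g 0 0] S(1) by simp

lemma S_sum: "(\<And>i. i \<in> I \<Longrightarrow> f i \<in> S) \<Longrightarrow> sum f I \<in> S"
  by (induction I rule: infinite_finite_induct) (auto intro: S)

lemma act_sum: "g \<in> G \<Longrightarrow> (\<And>i. i \<in> I \<Longrightarrow> f i \<in> S) \<Longrightarrow> act g (sum f I) = (\<Sum>i\<in>I. act g (f i))"
  by (induction I rule: infinite_finite_induct) (auto simp: act_0 act_add S_sum)

lemma trace_fixed:
  assumes K: "subgroup K M" "K \<subseteq> G" and y: "y \<in> S"
  shows "(\<Sum>\<tau>\<in>K. act \<tau> y) \<in> fixed_ring K"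
proof -
  interpret K: subgroup K M by fact
  have "act g (\<Sum>\<tau>\<in>K. act \<tau> y) = (\<Sum>\<tau>\<in>K. act \<tau> y)" if g: "g \<in> K" for g
  proof -
    have "act g (\<Sum>\<tau>\<in>K. act \<tau> y) = (\<Sum>\<tau>\<in>K. act (g \<otimes> \<tau>) y)"
      using g K(2) y by (subst act_sum) (auto intro!: act_closed sum.cong simp: act_act subset_iff)
    also have "\<dots> = (\<Sum>\<tau>\<in>K. act \<tau> y)"
      using g
      by (intro sum.reindex_bij_witness[of K "\<lambda>\<tau>. inv g \<otimes> \<tau>" "\<lambda>\<tau>. g \<otimes> \<tau>"])
        (auto simp: m_assoc[symmetric])
    finally show ?thesis .
  qed
  moreover have "(\<Sum>\<tau>\<in>K. act \<tau> y) \<in> S"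
    using K(2) y by (auto intro!: S_sum act_closed)
  ultimately show ?thesis by (simp add: fixed_ring_def)
qed

text \<open>
  Applying \<open>\<tau>\<close> to the relation for \<open>\<sigma> = \<tau>\<^sup>-\<^sup>1\<close> gives \<open>\<Sum>e. (\<tau> x\<^sub>e) e = 0\<close>. Multiplied by \<open>\<tau> y\<close> and summed
  over \<open>\<tau> \<in> K\<close>, this is a relation whose coefficients are the traces of \<open>x\<^sub>e y\<close>, which are invariant
  under \<open>K\<close> and hence zero. As \<open>y\<close> is arbitrary, Dedekind's lemma forces \<open>\<tau> x\<^sub>e = 0\<close>.
\<close>

lemma conjugates_independent:
  assumes K: "subgroup K M" "K \<subseteq> G"
    and E: "module_basis (fixed_ring K) A E" "A \<subseteq> S"
    and T: "finite T" "T \<subseteq> E" "\<And>e. e \<in> T \<Longrightarrow> x e \<in> S"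
    and rel: "\<And>\<sigma>. \<sigma> \<in> K \<Longrightarrow> (\<Sum>e\<in>T. x e * act \<sigma> e) = 0"
    and e: "e \<in> T"
  shows "x e = 0"
proof -
  interpret K: subgroup K M by fact
  have TS: "e \<in> S" if "e \<in> T" for e
    using that T(2) E(2) module_basis_subset[OF E(1)] by auto
  have KG: "\<tau> \<in> G" if "\<tau> \<in> K" for \<tau> using K(2) that by auto
  have rel': "(\<Sum>e\<in>T. act \<tau> (x e) * e) = 0" if \<tau>: "\<tau> \<in> K" for \<tau>
  proof -
    have "act \<tau> (\<Sum>e\<in>T. x e * act (inv \<tau>) e) = (\<Sum>e\<in>T. act \<tau> (x e) * e)"
    proof (subst act_sum)
      show "\<tau> \<in> G" by (rule KG[OF \<tau>])
      show "x e * act (inv \<tau>) e \<in> S" if "e \<in> T" for e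
        using that \<tau> by (intro S act_closed TS T KG) auto
      show "(\<Sum>e\<in>T. act \<tau> (x e * act (inv \<tau>) e)) = (\<Sum>e\<in>T. act \<tau> (x e) * e)"
      proof (rule sum.cong[OF refl])
        fix e assume e: "e \<in> T"
        have "act \<tau> (act (inv \<tau>) e) = e"
          using act_act[of \<tau> "inv \<tau>" e] \<tau> e by (simp add: KG TS act_one)
        then show "act \<tau> (x e * act (inv \<tau>) e) = act \<tau> (x e) * e"
          using \<tau> e by (simp add: act_mult act_closed KG TS T(3))
      qed
    qed
    then show ?thesis using rel[of "inv \<tau>"] \<tau> act_0[OF KG[OF \<tau>]] by simp
  qed
  have trace: "(\<Sum>\<tau>\<in>K. act \<tau> (x e) * act \<tau> y) = 0" if y: "y \<in> S" for y
  proof -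
    have "(\<Sum>e\<in>T. (\<Sum>\<tau>\<in>K. act \<tau> (x e * y)) * e) =
        (\<Sum>\<tau>\<in>K. act \<tau> y * (\<Sum>e\<in>T. act \<tau> (x e) * e))"
      unfolding sum_distrib_left sum_distrib_right
      by (subst sum.swap) (auto intro!: sum.cong simp: act_mult KG T(3) y mult_ac)
    also have "\<dots> = 0" using rel' by simp
    finally have "(\<Sum>\<tau>\<in>K. act \<tau> (x e * y)) = 0"
      using T(3) y by (intro module_basis_independent[OF E(1) T(1,2) trace_fixed[OF K] _ e]) (auto intro: S)
    then show ?thesis using T(3)[OF e] y by (simp add: act_mult KG)
  qed
  have "finite K" using K(2) G(2) by (rule finite_subset)
  have "act \<one> (x e) = 0"
  proof (rule characters_independent[of S K act "\<lambda>\<tau>. act \<tau> (x e)"])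
    show "\<exists>s\<in>S. act \<tau> s \<noteq> act \<sigma> s" if "\<tau> \<in> K" "\<sigma> \<in> K" "\<tau> \<noteq> \<sigma>" for \<tau> \<sigma>
      using that by (intro faithful KG)
    show "x = 0 \<or> y = 0" if "x \<in> S" "y \<in> S" "x * y = 0" for x y
      using that by (rule domain)
  qed (use \<open>finite K\<close> KG T(3)[OF e] trace in \<open>auto intro: S act_closed act_1 act_mult\<close>)
  then show ?thesis using T(3)[OF e] by (simp add: act_one)
qed

text \<open>
  The coefficients of an \<open>H\<close>-invariant \<open>h\<close> also solve the equations obtained by applying \<open>g \<in> G\<close> to
  \<open>h = \<Sum>e. c\<^sub>e e\<close>, and the equation for \<open>\<sigma>\<close> is carried by \<open>g\<close> to the equation for \<open>g \<sigma>\<close> with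
  coefficients \<open>g c\<^sub>e\<close>. Comparing the two at each \<open>\<sigma> \<in> K\<close> shows \<open>g c\<^sub>e = c\<^sub>e\<close>.
\<close>

theorem basis_descends:
  assumes H: "subgroup H M" "H \<subseteq> G" and K: "subgroup K M" "K \<subseteq> G" and GKH: "G = K <#> H"
    and E: "module_basis (fixed_ring K) (fixed_ring (K \<inter> H)) E" "E \<subseteq> fixed_ring H"
  shows "module_basis (fixed_ring G) (fixed_ring H) E"
proof -
  interpret K: subgroup K M by fact
  interpret H: subgroup H M by fact
  interpret G: subgroup G M by (rule G)
  have KG: "\<tau> \<in> G" if "\<tau> \<in> K" for \<tau> using K(2) that by auto
  have HG: "\<tau> \<in> G" if "\<tau> \<in> H" for \<tau> using H(2) that by auto
  have GK: "fixed_ring G \<subseteq> fixed_ring K"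
    using K(2) by (auto simp: fixed_ring_def)
  have "h \<in> combinations (fixed_ring G) E" if h: "h \<in> fixed_ring H" for h
  proof -
    have "h \<in> combinations (fixed_ring K) E"
      using h module_basis_combinations[OF E(1)] by (auto simp: fixed_ring_def)
    then obtain T c where T: "finite T" "T \<subseteq> E" and cK: "c ` T \<subseteq> fixed_ring K"
      and hc: "h = (\<Sum>e\<in>T. c e * e)"
      by (rule combinationsE)
    have cS: "c e \<in> S" if "e \<in> T" for e using cK that by (auto simp: fixed_ring_def)
    have TS: "e \<in> S" and TH: "\<And>\<eta>. \<eta> \<in> H \<Longrightarrow> act \<eta> e = e" if "e \<in> T" for e
      using T(2) E(2) that by (auto simp: fixed_ring_def)
    have hS: "h \<in> S" and hH: "\<And>\<eta>. \<eta> \<in> H \<Longrightarrow> act \<eta> h = h"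
      using h by (auto simp: fixed_ring_def)
    have conj: "act g h = (\<Sum>e\<in>T. c e * act g e)" if "g \<in> G" for g
    proof -
      obtain \<kappa> \<eta> where \<kappa>: "\<kappa> \<in> K" and \<eta>: "\<eta> \<in> H" and g: "g = \<kappa> \<otimes> \<eta>"
        using \<open>g \<in> G\<close> GKH unfolding set_mult_def by blast
      have "act g h = act \<kappa> h"
        using \<kappa> \<eta> hS hH by (simp add: g act_act KG HG)
      also have "\<dots> = (\<Sum>e\<in>T. act \<kappa> (c e) * act \<kappa> e)"
        unfolding hc using \<kappa> cS TS by (simp add: act_sum S act_mult KG)
      also have "\<dots> = (\<Sum>e\<in>T. c e * act g e)"
        using \<kappa> \<eta> cK TS TH
        by (intro sum.cong refl) (auto simp: g act_act KG HG fixed_ring_def image_subset_iff)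
      finally show ?thesis .
    qed
    have "c e \<in> fixed_ring G" if e: "e \<in> T" for e
    proof -
      have "act g (c e) - c e = 0" if g: "g \<in> G" for g
      proof (rule conjugates_independent[OF K E(1) _ T _ _ e])
        show "fixed_ring (K \<inter> H) \<subseteq> S" by (auto simp: fixed_ring_def)
        show "act g (c e) - c e \<in> S" if "e \<in> T" for e
          using that g by (intro S act_closed cS)
        fix \<sigma> assume "\<sigma> \<in> K"
        then have \<sigma>: "\<sigma> \<in> G" by (rule KG)
        have \<sigma>': "inv g \<otimes> \<sigma> \<in> G" using g \<sigma> by simp
        have cancel: "act g (act (inv g \<otimes> \<sigma>) y) = act \<sigma> y" if "y \<in> S" for y
          using act_act[OF g \<sigma>' that] g \<sigma> by (simp add: m_assoc[symmetric])
        \<comment> \<open>the image under \<open>g\<close> of the equation for \<open>g\<^sup>-\<^sup>1 \<sigma>\<close>\<close>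
        have "act \<sigma> h = act g (act (inv g \<otimes> \<sigma>) h)" using cancel[OF hS] by simp
        also have "\<dots> = (\<Sum>e\<in>T. act g (c e) * act g (act (inv g \<otimes> \<sigma>) e))"
          unfolding conj[OF \<sigma>'] using g \<sigma>' cS TS by (simp add: act_sum S act_mult act_closed)
        also have "\<dots> = (\<Sum>e\<in>T. act g (c e) * act \<sigma> e)"
          by (intro sum.cong refl) (simp add: cancel TS)
        finally show "(\<Sum>e\<in>T. (act g (c e) - c e) * act \<sigma> e) = 0"
          using conj[OF \<sigma>] by (simp add: left_diff_distrib sum_subtractf)
      qed
      then show ?thesis using cS[OF e] by (simp add: fixed_ring_def)
    qed
    then show ?thesis using hc by (intro combinationsI[OF T]) auto
  qed
  then show ?thesis
    unfolding module_basis_def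
  proof (intro conjI allI impI ballI subsetI)
    show "e \<in> fixed_ring H" if "e \<in> E" for e using E(2) that by auto
    show "c e = 0" if "finite T" "T \<subseteq> E" "c ` T \<subseteq> fixed_ring G" "(\<Sum>e\<in>T. c e * e) = 0" "e \<in> T"
      for T c e
      by (rule module_basis_independent[OF E(1) that(1,2) _ that(4,5)]) (use that(3) GK in auto)
  qed
qed

end

section \<open>The action on polynomials\<close>

lemma poly_subalgebra_coord_ring: "poly_subalgebra (coord_ring B :: ('v, 'k::comm_ring_1) mpoly set)"
  unfolding poly_subalgebra_def
proof (intro conjI ballI)
  show "range mconst \<subseteq> (coord_ring B :: ('v, 'k) mpoly set)"
    by (auto simp: coord_ring_def mconst_def split: if_splits)
  fix p q :: "('v, 'k) mpoly" assume p: "p \<in> coord_ring B" and q: "q \<in> coord_ring B"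
  show "p + q \<in> coord_ring B"
    using p q keys_add[of p q] unfolding coord_ring_def by blast
  have "Poly_Mapping.keys (m + n) \<subseteq> B"
    if "m \<in> Poly_Mapping.keys p" "n \<in> Poly_Mapping.keys q" for m n
    using that p q keys_add[of m n] unfolding coord_ring_def by blast
  then show "p * q \<in> coord_ring B"
    using keys_mult[of p q] unfolding coord_ring_def by blast
qed

lemma mvar_in_coord_ring: "b \<in> B \<Longrightarrow> mvar b \<in> coord_ring B"
  by (auto simp: coord_ring_def mvar_def split: if_splits)

lemma msubst_in_subalgebra:
  fixes \<sigma> :: "'x \<Rightarrow> ('y, 'k::comm_ring_1) mpoly"
  assumes A: "poly_subalgebra A" and \<sigma>: "\<And>x. \<sigma> x \<in> A"
  shows "msubst \<sigma> p \<in> A"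
proof -
  note closed = poly_subalgebra_closed[OF A]
  have power: "\<sigma> x ^ n \<in> A" for x n
    by (induction n) (auto intro: closed \<sigma>)
  have "(\<Prod>x\<in>X. \<sigma> x ^ f x) \<in> A" for X and f :: "'x \<Rightarrow> nat"
    by (induction X rule: infinite_finite_induct) (auto intro: closed power)
  then show ?thesis unfolding msubst_def by (intro closed) auto
qed

lemma linear_form_in_coord_ring: "linear_form B \<phi> \<in> coord_ring B"
  unfolding linear_form_def
  by (intro poly_subalgebra_closed[OF poly_subalgebra_coord_ring] mvar_in_coord_ring)

definition homogeneous :: "nat \<Rightarrow> ('x, 'k::comm_ring_1) mpoly \<Rightarrow> bool" where
  "homogeneous d p \<longleftrightarrow> (\<forall>e. hom_part e p = (p when e = d))"

lemma homogeneous_mult: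
  assumes "homogeneous a p" "homogeneous b q"
  shows "homogeneous (a + b) (p * q)"
  unfolding homogeneous_def
proof
  fix d
  have "hom_part d (p * q) = (\<Sum>e\<le>d. if e = a then p * q when d - e = b else 0)"
    unfolding hom_part_mult using assms
    by (intro sum.cong) (auto simp: homogeneous_def when_def)
  then show "hom_part d (p * q) = (p * q when d = a + b)"
    by (auto simp: when_def)
qed

lemma homogeneous_mconst: "homogeneous 0 (mconst c)"
  by (auto simp: homogeneous_def mconst_def hom_part_single when_def total_degree_def)

lemma homogeneous_one: "homogeneous 0 1"
  using homogeneous_mconst[of 1] by simp

lemma homogeneous_sum: "(\<And>i. i \<in> I \<Longrightarrow> homogeneous d (f i)) \<Longrightarrow> homogeneous d (sum f I)"
  by (simp add: homogeneous_def hom_part_sum when_def)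

lemma homogeneous_monomial_value:
  fixes \<sigma> :: "'x \<Rightarrow> ('y, 'k::comm_ring_1) mpoly"
  assumes "\<And>x. homogeneous 1 (\<sigma> x)"
  shows "homogeneous (total_degree m) (monomial_value \<sigma> m)"
proof -
  have power: "homogeneous n (\<sigma> x ^ n)" for x n
    using homogeneous_mult[OF assms] by (induction n) (auto simp: homogeneous_one)
  have "homogeneous (sum f X) (\<Prod>x\<in>X. \<sigma> x ^ f x)" for X and f :: "'x \<Rightarrow> nat"
    by (induction X rule: infinite_finite_induct) (auto intro: homogeneous_one homogeneous_mult power)
  then show ?thesis by (simp add: monomial_value_def total_degree_def)
qed

lemma hom_part_msubst:
  assumes "\<And>x. homogeneous 1 (\<sigma> x)"
  shows "hom_part d (msubst \<sigma> p) = msubst \<sigma> (hom_part d p)"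
proof (induction p rule: poly_mapping_additive_induct)
  case (single m c)
  then show ?case
    using homogeneous_monomial_value[OF assms, of m]
    by (auto simp: msubst_single hom_part_mconst_mult hom_part_single homogeneous_def when_def)
qed (simp_all add: hom_part_add msubst_add)

lemma homogeneous_linear_form: "homogeneous 1 (linear_form B \<phi>)"
proof -
  have "homogeneous 1 (mvar b)" for b
    unfolding homogeneous_def mvar_def hom_part_single by (auto simp: total_degree_def when_def)
  from homogeneous_mult[OF homogeneous_mconst this] show ?thesis
    unfolding linear_form_def by (intro homogeneous_sum) simp
qed

lemma graded_coord_ring: "graded (coord_ring B)"
proof -
  have "Poly_Mapping.keys (hom_part d p) \<subseteq> Poly_Mapping.keys p" for d and p :: "('a, 'b) mpoly"
    by (auto simp: in_keys_iff lookup_hom_part when_def split: if_splits)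
  then show ?thesis unfolding graded_def coord_ring_def by blast
qed

lemma linear_inv_into:
  assumes "Vector_Spaces.linear scale scale x" "bij x"
  shows "Vector_Spaces.linear scale scale (inv_into UNIV x)"
proof -
  interpret x: Vector_Spaces.linear scale scale x by fact
  have "inv_into UNIV x (b1 + b2) = inv_into UNIV x b1 + inv_into UNIV x b2" for b1 b2
    using assms(2) by (intro inv_f_eq) (simp_all add: x.add bij_is_inj bij_is_surj surj_f_inv_f)
  moreover have "inv_into UNIV x (scale r b) = scale r (inv_into UNIV x b)" for r b
    using assms(2) by (intro inv_f_eq) (simp_all add: x.scale bij_is_inj bij_is_surj surj_f_inv_f)
  ultimately show ?thesis
    using assms(1) by (simp add: Vector_Spaces.linear_iff)
qed

lemma group_GL:
  assumes "vector_space scale"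
  shows "group (GL scale)"
proof (rule groupI)
  interpret vector_space scale by fact
  show "x \<otimes>\<^bsub>GL scale\<^esub> y \<in> carrier (GL scale)"
    if "x \<in> carrier (GL scale)" "y \<in> carrier (GL scale)" for x y
    using that by (auto simp: GL_def intro: bij_comp Vector_Spaces.linear_compose)
  show "\<one>\<^bsub>GL scale\<^esub> \<in> carrier (GL scale)"
    by (simp add: GL_def linear_id)
  show "\<exists>y\<in>carrier (GL scale). y \<otimes>\<^bsub>GL scale\<^esub> x = \<one>\<^bsub>GL scale\<^esub>"
    if "x \<in> carrier (GL scale)" for x
    using that
    by (intro bexI[of _ "inv_into UNIV x"])
      (auto simp: GL_def bij_imp_bij_inv bij_is_inj linear_inv_into)
qed (auto simp: GL_def comp_assoc)

context finite_dimensional_vector_space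
begin

text \<open>The functional \<open>b\<^sup>* \<circ> g\<^sup>-\<^sup>1\<close>, the image under \<open>g\<close> of the coordinate function of \<open>b\<close>.\<close>

abbreviation \<open>coord_image g b \<equiv> linear_form Basis (\<lambda>v. representation Basis (inv_into UNIV g v) b)\<close>

lemma poly_act_eq: "poly_act scale Basis g = msubst (coord_image g)"
  by (simp add: poly_act_def)

lemma poly_act_in_coord_ring: "poly_act scale Basis g p \<in> coord_ring Basis"
  unfolding poly_act_eq
  by (intro msubst_in_subalgebra poly_subalgebra_coord_ring linear_form_in_coord_ring)

lemma poly_act_id:
  assumes "p \<in> coord_ring Basis"
  shows "poly_act scale Basis id p = p"
proof -
  have "coord_image id b = mvar b" if "b \<in> Basis" for b
  proof -
    have "coord_image id b = (\<Sum>c\<in>Basis. if c = b then mvar c else 0)"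
      unfolding linear_form_def inv_id
      by (intro sum.cong) (auto simp: representation_basis[OF independent_Basis])
    then show ?thesis using that finite_Basis by simp
  qed
  then show ?thesis
    unfolding poly_act_eq
    using msubst_cong_coord_ring[OF assms, of "coord_image id" mvar] by (simp add: msubst_mvar_id)
qed

lemma representation_linear_image:
  assumes "Vector_Spaces.linear scale scale f"
  shows "representation Basis (f v) b =
    (\<Sum>c\<in>Basis. representation Basis v c * representation Basis (f c) b)"
proof -
  interpret f: Vector_Spaces.linear scale scale f by fact
  have span: "x \<in> span Basis" for x by (simp add: span_Basis)
  have "f v = f (\<Sum>c\<in>Basis. scale (representation Basis v c) c)"
    by (simp add: sum_representation_eq[OF independent_Basis span finite_Basis subset_refl])
  also have "\<dots> = (\<Sum>c\<in>Basis. scale (representation Basis v c) (f c))"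
    by (simp add: f.sum f.scale)
  finally show ?thesis
    by (simp add: representation_sum[OF independent_Basis span]
        representation_scale[OF independent_Basis span])
qed

text \<open>
  On the variables this is the product rule for the matrices of \<open>h\<^sup>-\<^sup>1\<close> and \<open>g\<^sup>-\<^sup>1\<close>, whose order is
  reversed once by inversion and once by passing to the dual space.
\<close>

lemma poly_act_comp:
  assumes "g \<in> carrier (GL scale)" "h \<in> carrier (GL scale)"
  shows "poly_act scale Basis (g \<circ> h) p = poly_act scale Basis g (poly_act scale Basis h p)"
proof -
  have inv: "inv_into UNIV (g \<circ> h) = inv_into UNIV h \<circ> inv_into UNIV g"
    using assms by (intro o_inv_distrib) (auto simp: GL_def)
  have lin: "Vector_Spaces.linear scale scale (inv_into UNIV h)"
    using assms(2) by (simp add: GL_def linear_inv_into)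
  have "msubst (coord_image g) (coord_image h b) = coord_image (g \<circ> h) b" for b
  proof -
    let ?r = "representation Basis" and ?g = "inv_into UNIV g" and ?h = "inv_into UNIV h"
    have "msubst (coord_image g) (coord_image h b) =
        (\<Sum>c\<in>Basis. \<Sum>d\<in>Basis. mconst (?r (?g d) c * ?r (?h c) b) * mvar d)"
      by (simp add: linear_form_def[of _ "\<lambda>v. ?r (?h v) b"] msubst_sum msubst_mult)
        (simp add: linear_form_def sum_distrib_left mult_ac)
    also have "\<dots> = (\<Sum>d\<in>Basis. mconst (\<Sum>c\<in>Basis. ?r (?g d) c * ?r (?h c) b) * mvar d)"
      by (subst sum.swap) (simp add: mconst_sum sum_distrib_right)
    also have "\<dots> = coord_image (g \<circ> h) b"
      by (simp add: linear_form_def inv representation_linear_image[OF lin, symmetric])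
    finally show ?thesis .
  qed
  then show ?thesis by (simp add: poly_act_eq msubst_msubst)
qed

text \<open>The action on the coordinate functions determines the matrix of the inverse.\<close>

lemma poly_act_faithful:
  assumes g: "g \<in> carrier (GL scale)" and h: "h \<in> carrier (GL scale)" and "g \<noteq> h"
  shows "\<exists>p\<in>coord_ring Basis. poly_act scale Basis g p \<noteq> poly_act scale Basis h p"
proof (rule ccontr)
  assume "\<not> ?thesis"
  then have eq: "poly_act scale Basis g p = poly_act scale Basis h p" if "p \<in> coord_ring Basis" for p
    using that by blast
  let ?r = "representation Basis" and ?g = "inv_into UNIV g" and ?h = "inv_into UNIV h"
  have span: "x \<in> span Basis" for x by (simp add: span_Basis)
  have coeff: "Poly_Mapping.lookup (linear_form Basis \<phi>) (Poly_Mapping.single c 1) = \<phi> c"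
    if "c \<in> Basis" for \<phi> :: "'b \<Rightarrow> 'a" and c
  proof -
    have single: "Poly_Mapping.single d (1::nat) = Poly_Mapping.single c 1 \<longleftrightarrow> d = c" for d
      by (metis keys_single singleton_inject zero_neq_one)
    have "Poly_Mapping.lookup (linear_form Basis \<phi>) (Poly_Mapping.single c 1) =
        (\<Sum>d\<in>Basis. if d = c then \<phi> c else 0)"
      unfolding linear_form_def lookup_sum
      by (intro sum.cong refl)
        (simp add: lookup_mconst_mult mvar_def lookup_single when_def single del: One_nat_def)
    then show ?thesis using that finite_Basis by simp
  qed
  have basis: "?r (?g c) b = ?r (?h c) b" if "b \<in> Basis" "c \<in> Basis" for b c
    using eq[OF mvar_in_coord_ring[OF that(1)]] coeff[OF that(2), of "\<lambda>v. ?r (?g v) b"]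
      coeff[OF that(2), of "\<lambda>v. ?r (?h v) b"]
    by (simp add: poly_act_eq)
  have rep: "?r (?g v) b = ?r (?h v) b" if "b \<in> Basis" for v b
    using g h basis[OF that]
    by (simp add: GL_def linear_inv_into representation_linear_image[of ?g v]
        representation_linear_image[of ?h v])
  have "?g v = ?h v" for v
  proof -
    have "(\<Sum>b\<in>Basis. scale (?r (?g v) b) b) = (\<Sum>b\<in>Basis. scale (?r (?h v) b) b)"
      by (intro sum.cong refl) (simp add: rep)
    then show ?thesis
      by (simp add: sum_representation_eq[OF independent_Basis span finite_Basis subset_refl])
  qed
  then have "?g = ?h" by (rule ext)
  then have "inv_into UNIV ?g = inv_into UNIV ?h" by (rule arg_cong)
  then show False using g h \<open>g \<noteq> h\<close> by (simp add: GL_def inv_inv_eq)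
qed

lemma poly_subalgebra_invariant_ring: "poly_subalgebra (invariant_ring scale Basis L)"
  using poly_subalgebra_coord_ring[of Basis]
  by (auto simp: poly_subalgebra_def invariant_ring_def poly_act_eq msubst_add msubst_mult)

lemma graded_invariant_ring: "graded (invariant_ring scale Basis L)"
  using graded_coord_ring[of Basis]
  by (auto simp: graded_def invariant_ring_def poly_act_eq hom_part_msubst[OF homogeneous_linear_form, symmetric])

lemma finite_domain_action_poly_act:
  assumes "subgroup G (GL scale)" "finite G"
  shows "finite_domain_action (GL scale) (coord_ring Basis) (poly_act scale Basis) G"
proof -
  interpret GL: group "GL scale" by (rule group_GL) unfold_locales
  interpret G: subgroup G "GL scale" by fact
  have GL: "g \<in> carrier (GL scale)" if "g \<in> G" for g
    using G.subset that by auto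
  note closed = poly_subalgebra_closed[OF poly_subalgebra_coord_ring[of Basis]]
  show ?thesis
  proof unfold_locales
    show "p = 0 \<or> q = 0" if "p \<in> coord_ring Basis" "q \<in> coord_ring Basis" "p * q = 0"
      for p q :: "('b, 'a) mpoly"
      using coord_ring_no_zero_divisors[OF finite_Basis that] .
    show "poly_act scale Basis (g \<otimes>\<^bsub>GL scale\<^esub> h) p = poly_act scale Basis g (poly_act scale Basis h p)"
      if "g \<in> G" "h \<in> G" for g h p
      using poly_act_comp[OF GL GL, OF that] by (simp add: GL_def)
    show "poly_act scale Basis \<one>\<^bsub>GL scale\<^esub> p = p" if "p \<in> coord_ring Basis" for p
      using poly_act_id[OF that] by (simp add: GL_def)
    show "\<exists>p\<in>coord_ring Basis. poly_act scale Basis g p \<noteq> poly_act scale Basis h p"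
      if "g \<in> G" "h \<in> G" "g \<noteq> h" for g h
      using poly_act_faithful[OF GL GL, OF that] .
  qed (use assms in \<open>simp_all add: closed poly_act_in_coord_ring\<close>,
      simp_all add: poly_act_eq msubst_add msubst_mult)
qed

end

section \<open>Descent of freeness to the full group\<close>

theorem proposition8:
  fixes scale :: "'k::field \<Rightarrow> 'v::ab_group_add \<Rightarrow> 'v"
    and B :: "'v set"
    and G W H K :: "('v \<Rightarrow> 'v) set"
  assumes V: "finite_dimensional_vector_space scale B"
    and G: "subgroup G (GL scale)" "finite G"
    and W: "W = generate (GL scale) {g \<in> G. fixes_hyperplane scale g}"
    and H: "subgroup H (GL scale)" "H \<subseteq> G"
    and K: "subgroup K (GL scale)" "W \<subseteq> K" "K \<subseteq> G"
    and GKH: "G = K <#>\<^bsub>GL scale\<^esub> H"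
    and free: "free_over (invariant_ring scale B K) (invariant_ring scale B (K \<inter> H))"
    and gen: "invariant_ring scale B (K \<inter> H) =
                poly_subalgebra hull (invariant_ring scale B K \<union> invariant_ring scale B H)"
  shows "free_over (invariant_ring scale B G) (invariant_ring scale B H)"
proof -
  interpret V: finite_dimensional_vector_space scale B by (rule V)
  interpret finite_domain_action "GL scale" "coord_ring B" "poly_act scale B" G
    by (rule V.finite_domain_action_poly_act[OF G])
  let ?I = "invariant_ring scale B"
  have fixed: "fixed_ring L = ?I L" for L
    by (simp add: fixed_ring_def invariant_ring_def)
  note subalg = V.poly_subalgebra_invariant_ring and graded = V.graded_invariant_ring
  have free_iff: "free_over (?I L) (?I L') \<longleftrightarrow> (\<exists>E. module_basis (?I L) (?I L') E)" for L L'
    by (intro free_over_iff_module_basis poly_subalgebra_closed[OF subalg])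
  obtain E where E: "module_basis (?I K) (?I (K \<inter> H)) E"
    using free free_iff by blast
  have "?I K \<subseteq> ?I (K \<inter> H)" "?I H \<subseteq> ?I (K \<inter> H)"
    by (auto simp: invariant_ring_def)
  moreover have "?I (K \<inter> H) \<subseteq> module_span (?I K) (?I H)"
    unfolding gen by (rule hull_subset_module_span[OF subalg subalg])
  ultimately obtain F where F: "F \<subseteq> ?I H" "module_basis (?I K) (?I (K \<inter> H)) F"
    using graded_free_basis_in_generators[OF subalg graded subalg graded _ graded _ _ E] by blast
  have "module_basis (?I G) (?I H) F"
    using basis_descends[OF H K(1,3) GKH] F by (simp add: fixed)
  then show ?thesis using free_iff by blast
qed

end
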